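(* Let $n,c\in\mathbb{N}$ and $\mathbf{y}=(c^n)=(c,c,\ldots,c)\in\mathbb{N}^n$. Then $\left|\mathsf{PA}^{\mathrm{inv},\uparrow}_n(\mathbf{y})\right|=C_n$, where $C_n=\frac{1}{n+1}\binom{2n}{n}$ is the $n$th Catalan number.
   Context: $\mathbb{N}=\{1,2,3,\ldots\}$ and $[k]=\{1,\ldots,k\}$. Let $\mathbf{y}=(y_1,\ldots,y_n)\in\mathbb{N}^n$ be car lengths and $m=\sum_{i=1}^n y_i$. A one-way street has spots $1,\ldots,m$, initially empty. Given preferences $\mathbf{x}=(x_1,\ldots,x_n)\in[m]^n$, cars $1,\ldots,n$ enter in this order; car $i$ parks in spots $j,j+1,\ldots,j+y_i-1$, where $j\ge x_i$ is the smallest integer such that $j+y_i-1\le m$ and all these spots are unoccupied; if no such $j$ exists, parking fails. If all cars park, $\mathbf{x}$ is a parking assortment for $\mathbf{y}$; $\mathsf{PA}_n(\mathbf{y})$ is the set of these. $\mathsf{PA}^{\mathrm{inv}}_n(\mathbf{y})$ is the set of (permutation) invariant parking assortments: those $\mathbf{x}\in\mathsf{PA}_n(\mathbf{y})$ all of whose rearrangements are also in $\mathsf{PA}_n(\mathbf{y})$ (with $\mathbf{y}$ fixed). $\mathsf{PA}^{\mathrm{inv},\uparrow}_n(\mathbf{y})=\{\mathbf{x}\in\mathsf{PA}^{\mathrm{inv}}_n(\mathbf{y}): x_1\le x_2\le\cdots\le x_n\}$. *)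

theory Defs
  imports Complex_Main "HOL-Library.Multiset"
begin

text \<open>
  Tuples are lists: \<open>y\<close> lists the car lengths and \<open>x\<close> the preferences, in order of arrival.
  The street has spots \<open>1, \<dots>, m\<close>, and \<open>occ\<close> is the set of occupied spots.
\<close>

text \<open>
  A car of length \<open>l\<close> with preference \<open>p\<close> may occupy the spots \<open>j, \<dots>, j + l - 1\<close>.  Car lengths
  are positive, so the subtraction on natural numbers does not truncate.
\<close>

definition fits :: "nat \<Rightarrow> nat set \<Rightarrow> nat \<Rightarrow> nat \<Rightarrow> nat \<Rightarrow> bool" where
  "fits m occ p l j \<longleftrightarrow> p \<le> j \<and> j + l - 1 \<le> m \<and> {j..j + l - 1} \<inter> occ = {}"

fun all_park :: "nat \<Rightarrow> nat set \<Rightarrow> nat list \<Rightarrow> nat list \<Rightarrow> bool" where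
  "all_park m occ [] [] \<longleftrightarrow> True"
| "all_park m occ (p # ps) (l # ls) \<longleftrightarrow>
     (\<exists>j. fits m occ p l j) \<and>
     (let j = (LEAST j. fits m occ p l j) in all_park m (occ \<union> {j..j + l - 1}) ps ls)"
| "all_park m occ _ _ \<longleftrightarrow> False"

definition PA :: "nat list \<Rightarrow> nat list set" where
  "PA y = {x. length x = length y \<and> set x \<subseteq> {1..sum_list y} \<and> all_park (sum_list y) {} x y}"

definition PA_inv :: "nat list \<Rightarrow> nat list set" where
  "PA_inv y = {x \<in> PA y. \<forall>x'. mset x' = mset x \<longrightarrow> x' \<in> PA y}"

definition PA_inv_incr :: "nat list \<Rightarrow> nat list set" where
  "PA_inv_incr y = {x \<in> PA_inv y. sorted x}"

end

theory Submission
  imports Defs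
begin

text \<open>
  If all cars have length \<open>c\<close>, a preference \<open>p\<close> of an invariant assortment can be moved to the
  front; that car parks exactly at \<open>p\<close>, and the spots \<open>1, \<dots>, p - 1\<close> are then tiled by cars of
  length \<open>c\<close>, so \<open>c\<close> divides \<open>p - 1\<close>.  Hence all preferences have the form \<open>c * a + 1\<close>, and parking
  proceeds in blocks of \<open>c\<close> spots as for classical parking functions.  The increasing ones are
  the weakly increasing lists with \<open>a ! i \<le> i\<close>, counted by the ballot numbers.
\<close>

section \<open>Occupied spots at the end of parking\<close>

text \<open>Where no position fits, \<open>LEAST\<close> is unspecified, so the value is meaningful
  only together with \<open>all_park\<close>.\<close>

fun final_occ :: "nat \<Rightarrow> nat set \<Rightarrow> nat list \<Rightarrow> nat list \<Rightarrow> nat set" where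
  "final_occ m occ (p # ps) (l # ls) =
     (let j = (LEAST j. fits m occ p l j) in final_occ m (occ \<union> {j..j + l - 1}) ps ls)"
| "final_occ m occ _ _ = occ"

text \<open>This hides \<open>LEAST\<close>: the counting inductions below use only that the chosen
  \<open>j\<close> fits, not that it is minimal.\<close>

lemma all_park_Cons:
  assumes "all_park m occ (p # ps) (l # ls)"
  obtains j where "fits m occ p l j" "all_park m (occ \<union> {j..j + l - 1}) ps ls"
    "final_occ m occ (p # ps) (l # ls) = final_occ m (occ \<union> {j..j + l - 1}) ps ls"
proof
  define j where "j = (LEAST j. fits m occ p l j)"
  show "fits m occ p l j"
    unfolding j_def using assms by (auto intro: LeastI_ex)
  show "all_park m (occ \<union> {j..j + l - 1}) ps ls"
    "final_occ m occ (p # ps) (l # ls) = final_occ m (occ \<union> {j..j + l - 1}) ps ls"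
    using assms by (simp_all add: j_def Let_def final_occ.simps(1))
qed

declare final_occ.simps(1) [simp del]

lemma final_occ_subset:
  assumes "all_park m occ ps ls" "\<forall>p\<in>set ps. p \<ge> 1" "occ \<subseteq> {1..m}"
  shows "final_occ m occ ps ls \<subseteq> {1..m}"
  using assms
proof (induction m occ ps ls rule: all_park.induct)
  case (2 m occ p ps l ls)
  obtain j where j: "fits m occ p l j" "all_park m (occ \<union> {j..j + l - 1}) ps ls"
    "final_occ m occ (p # ps) (l # ls) = final_occ m (occ \<union> {j..j + l - 1}) ps ls"
    "j = (LEAST j. fits m occ p l j)"
    using "2.prems"(1) by (simp add: Let_def LeastI_ex final_occ.simps(1))
  have "occ \<union> {j..j + l - 1} \<subseteq> {1..m}"
    using j(1) "2.prems"(2,3) by (auto simp: fits_def)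
  then show ?case
    using "2.IH" "2.prems" j by auto
qed auto

lemma card_final_occ:
  assumes "all_park m occ ps ls" "\<forall>l\<in>set ls. l \<ge> 1" "finite occ"
  shows "card (final_occ m occ ps ls) = card occ + sum_list ls"
  using assms
proof (induction ps arbitrary: occ ls)
  case Nil
  then show ?case by (cases ls) auto
next
  case (Cons p ps)
  then obtain l ls' where ls: "ls = l # ls'" by (cases ls) auto
  obtain j where j: "fits m occ p l j" "all_park m (occ \<union> {j..j + l - 1}) ps ls'"
    "final_occ m occ (p # ps) (l # ls') = final_occ m (occ \<union> {j..j + l - 1}) ps ls'"
    using Cons.prems(1) unfolding ls by (rule all_park_Cons)
  have "card (occ \<union> {j..j + l - 1}) = card occ + l"
    using j(1) Cons.prems(2,3) ls by (subst card_Un_disjoint) (auto simp: fits_def)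
  then show ?case
    using Cons.IH[OF j(2)] Cons.prems(2,3) by (simp add: ls j(3))
qed

text \<open>The cars take up as many spots as the street has and stay within it, so no gap
  remains.\<close>

lemma final_occ_eq:
  assumes "all_park (sum_list ls) {} ps ls" "\<forall>p\<in>set ps. p \<ge> 1" "\<forall>l\<in>set ls. l \<ge> 1"
  shows "final_occ (sum_list ls) {} ps ls = {1..sum_list ls}"
proof (rule card_subset_eq)
  show "final_occ (sum_list ls) {} ps ls \<subseteq> {1..sum_list ls}"
    using assms by (intro final_occ_subset) auto
  show "card (final_occ (sum_list ls) {} ps ls) = card {1..sum_list ls}"
    using card_final_occ[OF assms(1,3)] by simp
qed simp

text \<open>A car parked later lies entirely on one side of the occupied spot \<open>q\<close>.\<close>

lemma card_final_occ_left_mod: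
  assumes "all_park m occ ps ls" "\<forall>l\<in>set ls. l \<ge> 1 \<and> c dvd l" "finite occ" "q \<in> occ"
  shows "card (final_occ m occ ps ls \<inter> {..<q}) mod c = card (occ \<inter> {..<q}) mod c"
  using assms
proof (induction ps arbitrary: occ ls)
  case Nil
  then show ?case by (cases ls) auto
next
  case (Cons p ps)
  then obtain l ls' where ls: "ls = l # ls'" by (cases ls) auto
  obtain j where j: "fits m occ p l j" "all_park m (occ \<union> {j..j + l - 1}) ps ls'"
    "final_occ m occ (p # ps) (l # ls') = final_occ m (occ \<union> {j..j + l - 1}) ps ls'"
    using Cons.prems(1) unfolding ls by (rule all_park_Cons)
  let ?I = "{j..j + l - 1}"
  have disj: "?I \<inter> occ = {}"
    using j(1) by (simp add: fits_def)
  then have "q \<notin> ?I" using Cons.prems(4) by blast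
  then have "?I \<inter> {..<q} = ?I \<or> ?I \<inter> {..<q} = {}" by auto
  moreover have "card ?I = l" "c dvd l" using Cons.prems(2) ls by auto
  ultimately have "c dvd card (?I \<inter> {..<q})" by (metis card.empty dvd_0_right)
  moreover have "card ((occ \<union> ?I) \<inter> {..<q}) = card (occ \<inter> {..<q}) + card (?I \<inter> {..<q})"
    using disj Cons.prems(3) by (subst Int_Un_distrib2, subst card_Un_disjoint) auto
  ultimately have "card ((occ \<union> ?I) \<inter> {..<q}) mod c = card (occ \<inter> {..<q}) mod c"
    by (metis dvdE mod_mult_self2)
  then show ?case
    using Cons.IH[OF j(2)] Cons.prems(2-4) by (simp add: ls j(3))
qed

text \<open>Cars never park before their preference, so each one preferring \<open>q\<close> or
  later puts at least \<open>c\<close> new spots into \<open>{q..}\<close>; the other cars can only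
  add to that.\<close>

lemma card_final_occ_right:
  assumes "all_park m occ ps ls" "\<forall>l\<in>set ls. l \<ge> 1 \<and> c \<le> l" "finite occ"
  shows "card (occ \<inter> {q..}) + c * length (filter (\<lambda>p. q \<le> p) ps)
           \<le> card (final_occ m occ ps ls \<inter> {q..})"
  using assms
proof (induction ps arbitrary: occ ls)
  case Nil
  then show ?case by (cases ls) auto
next
  case (Cons p ps)
  then obtain l ls' where ls: "ls = l # ls'" by (cases ls) auto
  obtain j where j: "fits m occ p l j" "all_park m (occ \<union> {j..j + l - 1}) ps ls'"
    "final_occ m occ (p # ps) (l # ls') = final_occ m (occ \<union> {j..j + l - 1}) ps ls'"
    using Cons.prems(1) unfolding ls by (rule all_park_Cons)
  let ?I = "{j..j + l - 1}"
  have disj: "?I \<inter> occ = {}" and "p \<le> j"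
    using j(1) by (simp_all add: fits_def)
  have "card ?I = l" "c \<le> l" using Cons.prems(2) ls by auto
  moreover have "?I \<inter> {q..} = ?I" if "q \<le> p" using that \<open>p \<le> j\<close> by auto
  ultimately have "(if q \<le> p then c else 0) \<le> card (?I \<inter> {q..})" by auto
  moreover have "card ((occ \<union> ?I) \<inter> {q..}) = card (occ \<inter> {q..}) + card (?I \<inter> {q..})"
    using disj Cons.prems(3) by (subst Int_Un_distrib2, subst card_Un_disjoint) auto
  moreover have "card ((occ \<union> ?I) \<inter> {q..}) + c * length (filter (\<lambda>p. q \<le> p) ps)
           \<le> card (final_occ m (occ \<union> ?I) ps ls' \<inter> {q..})"
    using Cons.IH[OF j(2)] Cons.prems(2,3) by (simp add: ls)
  ultimately show ?case
    by (auto simp: ls j(3) split: if_splits)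
qed

section \<open>Necessary conditions on the preferences\<close>

lemma PA_inv_dvd:
  assumes x: "x \<in> PA_inv (replicate n c)" and c: "c \<ge> 1" and p: "p \<in> set x"
  shows "c dvd p - 1"
proof -
  let ?m = "n * c"
  define ps where "ps = remove1 p x"
  have "mset (p # ps) = mset x" using p by (simp add: ps_def)
  then have "p # ps \<in> PA (replicate n c)" using x unfolding PA_inv_def by blast
  then have PA: "length (p # ps) = n" "set (p # ps) \<subseteq> {1..?m}"
    "all_park ?m {} (p # ps) (replicate n c)"
    by (simp_all add: PA_def sum_list_replicate)
  then obtain k where n: "n = Suc k" by (cases n) auto
  have ex: "\<exists>j. fits ?m {} p c j" using PA(3) n by simp
  \<comment> \<open>On the empty street, a fitting position \<open>j \<ge> p\<close> shows that
    \<open>p\<close> itself fits, so the first car parks exactly at \<open>p\<close>.\<close>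
  have j: "(LEAST j. fits ?m {} p c j) = p"
    using ex by (intro Least_equality) (auto simp: fits_def)
  let ?I = "{p..p + c - 1}"
  have park: "all_park ?m ?I ps (replicate k c)"
    and fin: "final_occ ?m {} (p # ps) (replicate n c) = final_occ ?m ?I ps (replicate k c)"
    using PA(3) j by (simp_all add: n final_occ.simps(1))
  have "final_occ ?m {} (p # ps) (replicate n c) = {1..?m}"
    using final_occ_eq[of "replicate n c" "p # ps"] PA c by (force simp: sum_list_replicate)
  \<comment> \<open>Spot \<open>p\<close> is occupied from the first car on, and that car takes
    nothing to its left; the \<open>p - 1\<close> spots there are thus filled by later cars, giving
    a count of 0 modulo \<open>c\<close>.\<close>
  then have "card ({1..?m} \<inter> {..<p}) mod c = card (?I \<inter> {..<p}) mod c"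
    using card_final_occ_left_mod[OF park, of c p] c by (simp add: fin)
  moreover have "{1..?m} \<inter> {..<p} = {1..<p}" using PA(2) by auto
  moreover have "?I \<inter> {..<p} = {}" by auto
  ultimately show ?thesis by (auto simp: mod_eq_0_iff_dvd)
qed

text \<open>By sortedness the last \<open>n - i\<close> cars all prefer \<open>x ! i\<close> or
  later, so their \<open>c * (n - i)\<close> spots must find room in
  \<open>{x ! i..n * c}\<close>.\<close>

lemma sorted_PA_nth_le:
  assumes x: "x \<in> PA (replicate n c)" and c: "c \<ge> 1" and "sorted x" and i: "i < n"
  shows "x ! i \<le> c * i + 1"
proof -
  let ?m = "n * c" and ?q = "x ! i"
  have PA: "length x = n" "set x \<subseteq> {1..?m}" "all_park ?m {} x (replicate n c)"
    using x by (simp_all add: PA_def sum_list_replicate)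
  have "final_occ ?m {} x (replicate n c) = {1..?m}"
    using final_occ_eq[of "replicate n c" x] PA c by (force simp: sum_list_replicate)
  then have "c * length (filter (\<lambda>p. ?q \<le> p) x) \<le> card ({1..?m} \<inter> {?q..})"
    using card_final_occ_right[OF PA(3), of c ?q] c by simp
  moreover have q: "?q \<in> {1..?m}" using PA i nth_mem by blast
  then have "{1..?m} \<inter> {?q..} = {?q..?m}" by auto
  moreover have "n - i \<le> length (filter (\<lambda>p. ?q \<le> p) x)"
  proof -
    have "?q \<le> drop i x ! k" if "k < length (drop i x)" for k
      using \<open>sorted x\<close> that by (simp add: sorted_nth_mono)
    then have "filter (\<lambda>p. ?q \<le> p) (drop i x) = drop i x"
      by (metis filter_id_conv in_set_conv_nth)
    then have "length (filter (\<lambda>p. ?q \<le> p) (take i x @ drop i x)) \<ge> length (drop i x)"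
      unfolding filter_append by simp
    then show ?thesis using PA(1) by simp
  qed
  then have "c * (n - i) \<le> c * length (filter (\<lambda>p. ?q \<le> p) x)" by simp
  ultimately have "c * (n - i) \<le> Suc ?m - ?q" by (metis card_atLeastAtMost le_trans)
  moreover have "?m = c * (n - i) + c * i"
    using i by (simp add: mult.commute flip: distrib_left)
  ultimately show ?thesis using q by auto
qed

section \<open>Parking in blocks of equal length\<close>

text \<open>Blocks are numbered from 0 and spots from 1; the blocks with index below
  \<open>n\<close> tile the street \<open>{1..n * c}\<close>.\<close>

definition block :: "nat \<Rightarrow> nat \<Rightarrow> nat set" where
  "block c b = {c * b + 1..c * b + c}"

lemma mem_block_iff: "c \<ge> 1 \<Longrightarrow> s \<in> block c b \<longleftrightarrow> s \<ge> 1 \<and> (s - 1) div c = b"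
proof -
  assume c: "c \<ge> 1"
  have "s \<in> block c b \<longleftrightarrow> s \<ge> 1 \<and> c * b \<le> s - 1 \<and> s - 1 < c * b + c"
    unfolding block_def by auto
  also have "\<dots> \<longleftrightarrow> s \<ge> 1 \<and> (s - 1) div c = b"
    using c 
    by (auto simp: dividend_less_times_div add.commute intro!: div_nat_eqI simp flip: mult.commute)
  finally show ?thesis .
qed

text \<open>A car that fits at \<open>j\<close> has its first spot in a free block with index at
  least \<open>a\<close>, and \<open>b\<close> is the first such block. Parking thus follows the
  classical rule with blocks in place of spots.\<close>

lemma least_fits_block:
  assumes c: "c \<ge> 1" and b: "b < n" "a \<le> b" "b \<notin> B"
    and least: "\<And>b'. a \<le> b' \<Longrightarrow> b' < b \<Longrightarrow> b' \<in> B"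
  shows "fits (n * c) (\<Union>(block c ` B)) (c * a + 1) c (c * b + 1)"
    and "(LEAST j. fits (n * c) (\<Union>(block c ` B)) (c * a + 1) c j) = c * b + 1"
proof -
  have "c * b + c \<le> n * c"
    using mult_le_mono2[of "Suc b" n c] b(1) by (simp add: mult.commute)
  moreover have "block c b \<inter> \<Union>(block c ` B) = {}"
    using c b(3) by (auto simp: mem_block_iff)
  ultimately show fits: "fits (n * c) (\<Union>(block c ` B)) (c * a + 1) c (c * b + 1)"
    using b(2) by (auto simp: fits_def block_def)
  show "(LEAST j. fits (n * c) (\<Union>(block c ` B)) (c * a + 1) c j) = c * b + 1"
  proof (rule Least_equality)
    show "fits (n * c) (\<Union>(block c ` B)) (c * a + 1) c (c * b + 1)" by (fact fits)
  next
    fix j assume j: "fits (n * c) (\<Union>(block c ` B)) (c * a + 1) c j"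
    let ?d = "(j - 1) div c"
    have "j \<ge> c * a + 1" using j by (simp add: fits_def)
    then have "c * a \<le> j - 1" by simp
    then have "a \<le> ?d" using c by (simp add: less_eq_div_iff_mult_less_eq mult.commute)
    moreover have "j \<in> {j..j + c - 1}" using c by simp
    then have "j \<notin> \<Union>(block c ` B)" using j unfolding fits_def by blast
    then have "?d \<notin> B" using \<open>j \<ge> c * a + 1\<close> c by (auto simp: mem_block_iff)
    ultimately have "b \<le> ?d" using least by force
    then have "c * b \<le> j - 1" using c by (simp add: less_eq_div_iff_mult_less_eq mult.commute)
    then show "c * b + 1 \<le> j" using \<open>j \<ge> c * a + 1\<close> by simp
  qed
qed

text \<open>
  \<open>B\<close> is the set of occupied blocks.  The invariant \<open>inv\<close> is only required for positions \<open>d\<close> that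
  no car with preference below \<open>d\<close> can have crossed.
\<close>

lemma all_park_blocks:
  assumes c: "c \<ge> 1" and "B \<subseteq> {..<n}"
    and inv: "\<And>d. d \<le> n \<Longrightarrow> d = 0 \<or> d - 1 \<notin> B \<Longrightarrow>
          card (B \<inter> {d..}) + length (filter (\<lambda>a. d \<le> a) as) \<le> n - d"
    and "\<forall>a\<in>set as. a < n"
  shows "all_park (n * c) (\<Union>(block c ` B)) (map (\<lambda>a. c * a + 1) as) (replicate (length as) c)"
  using assms(2-)
proof (induction "as" arbitrary: B)
  case (Cons a "as")
  have fin: "finite B" using Cons.prems(1) finite_subset by blast
  have ex: "\<exists>b<n. a \<le> b \<and> b \<notin> B"
  proof (rule ccontr)
    assume "\<not> (\<exists>b<n. a \<le> b \<and> b \<notin> B)"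
    then have full: "{a..<n} \<subseteq> B" by auto
    \<comment> \<open>\<open>d\<close> is the left end of the run of occupied blocks that reaches
      the end of the street. The block before it, if any, is free, so the invariant applies at
      \<open>d\<close>; but the run already fills all \<open>n - d\<close> blocks and the car with
      preference \<open>a \<ge> d\<close> is still to come.\<close>
    define d where "d = (LEAST d. {d..<n} \<subseteq> B)"
    have d: "{d..<n} \<subseteq> B" "d \<le> a"
      unfolding d_def using full by (fact LeastI, fact Least_le)
    have "d - 1 \<notin> B" if "d \<noteq> 0"
    proof
      assume "d - 1 \<in> B"
      moreover have "{d - 1..<n} \<subseteq> insert (d - 1) {d..<n}" by auto
      ultimately have "{d - 1..<n} \<subseteq> B" using d(1) by blast
      then have "d \<le> d - 1" unfolding d_def by (rule Least_le)
      then show False using that by simp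
    qed
    then have "card (B \<inter> {d..}) + length (filter (\<lambda>a. d \<le> a) (a # as)) \<le> n - d"
      using Cons.prems(3) d(2) by (intro Cons.prems(2)) auto
    moreover have "B \<inter> {d..} = {d..<n}" using d(1) Cons.prems(1) by auto
    ultimately show False using d(2) by simp
  qed
  define b where "b = (LEAST b. a \<le> b \<and> b \<notin> B)"
  have b: "a \<le> b \<and> b \<notin> B"
    unfolding b_def using ex by (metis (mono_tags, lifting) LeastI_ex)
  have least: "b' \<in> B" if "a \<le> b'" "b' < b" for b'
    using that not_less_Least[of b' "\<lambda>b. a \<le> b \<and> b \<notin> B"] by (auto simp: b_def)
  have "b < n" using ex Least_le[of "\<lambda>b. a \<le> b \<and> b \<notin> B"] unfolding b_def by force
  note fits = least_fits_block[OF c \<open>b < n\<close>, of a B, OF _ _ least]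
  have "all_park (n * c) (\<Union>(block c ` insert b B)) (map (\<lambda>a. c * a + 1) as)
      (replicate (length as) c)"
  proof (rule Cons.IH)
    fix d assume d: "d \<le> n" "d = 0 \<or> d - 1 \<notin> insert b B"
    then have old: "card (B \<inter> {d..}) + length (filter (\<lambda>a. d \<le> a) (a # as)) \<le> n - d"
      by (intro Cons.prems(2)) auto
    show "card (insert b B \<inter> {d..}) + length (filter (\<lambda>a. d \<le> a) as) \<le> n - d"
    proof (cases "d \<le> b")
      case True
      \<comment> \<open>If \<open>a < d \<le> b\<close>, the car would have crossed block
        \<open>d - 1\<close>, which is free. So this car passes from the second summand of the
        invariant to the first.\<close>
      have "d \<le> a"
      proof (rule ccontr)
        assume "\<not> d \<le> a"
        then have "d - 1 \<in> B" using True by (intro least) auto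
        then show False using d \<open>\<not> d \<le> a\<close> by auto
      qed
      then show ?thesis using old True b fin by (simp add: Int_insert_left)
    next
      case False
      then have "insert b B \<inter> {d..} = B \<inter> {d..}" by auto
      then show ?thesis using old by (auto split: if_splits)
    qed
  qed (use Cons.prems \<open>b < n\<close> in auto)
  moreover have "\<Union>(block c ` insert b B) = \<Union>(block c ` B) \<union> {c * b + 1..c * b + 1 + c - 1}"
    by (auto simp: block_def)
  ultimately show ?case
    using fits b by (auto simp: Let_def)
qed simp

section \<open>Ballot lists and their number\<close>

text \<open>The cap \<open>k\<close> on the entries is the second parameter of the ballot triangle
  and drives the recursion. At \<open>k = n\<close> these are all weakly increasing parking
  functions, with values counted from 0.\<close>

definition ballot_lists :: "nat \<Rightarrow> nat \<Rightarrow> nat list set" where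
  "ballot_lists n k =
     {as. length as = n \<and> sorted as \<and> (\<forall>i<n. as ! i \<le> i) \<and> (\<forall>a\<in>set as. a \<le> k)}"

lemma finite_ballot_lists: "finite (ballot_lists n k)"
proof (rule finite_subset)
  show "ballot_lists n k \<subseteq> {as. set as \<subseteq> {..k} \<and> length as = n}"
    by (auto simp: ballot_lists_def)
qed (simp add: finite_lists_length_eq)

lemma ballot_lists_0: "ballot_lists n 0 = {replicate n 0}"
  by (auto simp: ballot_lists_def intro: replicate_eqI)

text \<open>Split by the last entry, which is the largest: either it is at most \<open>k\<close>, or
  it is \<open>Suc k\<close> and can be removed. Conversely, \<open>k < n\<close> allows
  \<open>Suc k\<close> at index \<open>n\<close>.\<close>

lemma ballot_lists_Suc:
  assumes "k < n"
  shows "ballot_lists (Suc n) (Suc k) =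
           ballot_lists (Suc n) k \<union> (\<lambda>as. as @ [Suc k]) ` ballot_lists n (Suc k)"
proof (intro Set.equalityI subsetI)
  fix as assume as: "as \<in> ballot_lists (Suc n) (Suc k)"
  then obtain bs b where bs: "as = bs @ [b]" "length bs = n"
    by (cases "as" rule: rev_cases) (auto simp: ballot_lists_def)
  show "as \<in> ballot_lists (Suc n) k \<union> (\<lambda>as. as @ [Suc k]) ` ballot_lists n (Suc k)"
  proof (cases "b = Suc k")
    case True
    have "bs ! i \<le> i" if "i < n" for i
    proof -
      have "as ! i \<le> i" using as that by (simp add: ballot_lists_def)
      then show ?thesis using that bs by (simp add: nth_append)
    qed
    then have "bs \<in> ballot_lists n (Suc k)"
      using as bs by (auto simp: ballot_lists_def sorted_append)
    then show ?thesis using bs True by auto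
  next
    case False
    then have "b \<le> k" using as bs by (auto simp: ballot_lists_def)
    moreover have "\<forall>a\<in>set bs. a \<le> b"
      using as bs by (simp add: ballot_lists_def sorted_append)
    ultimately have "\<forall>a\<in>set as. a \<le> k"
      using bs by auto
    then have "as \<in> ballot_lists (Suc n) k"
      using as by (simp add: ballot_lists_def)
    then show ?thesis ..
  qed
next
  fix as assume "as \<in> ballot_lists (Suc n) k \<union> (\<lambda>as. as @ [Suc k]) ` ballot_lists n (Suc k)"
  then show "as \<in> ballot_lists (Suc n) (Suc k)"
    using assms by (auto simp: ballot_lists_def sorted_append nth_append less_Suc_eq)
qed

text \<open>The last index is \<open>n\<close>, so the value \<open>Suc n\<close> cannot occur. This
  is the boundary case of the recurrence.\<close>

lemma ballot_lists_diag: "ballot_lists (Suc n) (Suc n) = ballot_lists (Suc n) n"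
  by (fastforce simp: ballot_lists_def in_set_conv_nth)

text \<open>
  The ballot number \<open>(n + 1 - k) / (n + 1) * ((n + k) choose k)\<close>, written as a difference of
  binomials so that the recurrence is Pascal's rule.
\<close>

lemma card_ballot_lists:
  "k \<le> n \<Longrightarrow> card (ballot_lists n k) + ((n + k) choose Suc n) = (n + k) choose n"
proof (induction n arbitrary: k)
  case 0
  then show ?case by (simp add: ballot_lists_0)
next
  case (Suc n)
  note IH_n = Suc.IH
  show ?case using Suc.prems
  proof (induction k)
    case 0
    then show ?case by (simp add: ballot_lists_0)
  next
    case (Suc k)
    have IH: "card (ballot_lists (Suc n) k) + ((Suc n + k) choose Suc (Suc n))
        = (Suc n + k) choose Suc n"
      using Suc by simp
    show ?case
    proof (cases "k = n")
      case True
      \<comment> \<open>On the diagonal the count stays the same while Pascal's rule adds one middle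
        binomial of row \<open>2 * n + 1\<close> on each side; these two agree by symmetry.\<close>
      have "(Suc (2 * n)) choose n = (Suc (2 * n)) choose Suc n"
        by (subst binomial_symmetric) (simp_all add: numeral_2_eq_2)
      then show ?thesis
        using IH by (simp add: True ballot_lists_diag mult_2)
    next
      case False
      then have k: "k < n" using Suc.prems by simp
      have "card (ballot_lists (Suc n) (Suc k))
          = card (ballot_lists (Suc n) k) + card (ballot_lists n (Suc k))"
        unfolding ballot_lists_Suc[OF k]
      proof (subst card_Un_disjoint)
        show "ballot_lists (Suc n) k \<inter> (\<lambda>as. as @ [Suc k]) ` ballot_lists n (Suc k) = {}"
          by (auto simp: ballot_lists_def)
      qed (auto simp: finite_ballot_lists card_image inj_on_def)
      moreover have "card (ballot_lists n (Suc k)) + ((n + Suc k) choose Suc n)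
          = (n + Suc k) choose n"
        using k by (intro IH_n) simp
      ultimately show ?thesis using IH by simp
    qed
  qed
qed

lemma card_ballot_lists_diag:
  "real (card (ballot_lists n n)) = 1 / real (n + 1) * real ((2 * n) choose n)"
proof -
  have "card (ballot_lists n n) + ((2 * n) choose Suc n) = (2 * n) choose n"
    using card_ballot_lists[of n n] by (simp add: mult_2)
  \<comment> \<open>Absorption expresses the subtracted binomial through the central one, so that
    multiplying by \<open>Suc n\<close> leaves exactly one copy of the latter.\<close>
  moreover have "Suc n * ((2 * n) choose Suc n) = n * ((2 * n) choose n)"
    using Suc_times_binomial_add[of n "n - 1"] by (cases n) (simp_all add: mult_2)
  ultimately have "Suc n * card (ballot_lists n n) + n * ((2 * n) choose n)
      = Suc n * ((2 * n) choose n)"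
    by (metis distrib_left)
  then have "Suc n * card (ballot_lists n n) = (2 * n) choose n" by simp
  then have "real (Suc n) * real (card (ballot_lists n n)) = real ((2 * n) choose n)"
    by (metis of_nat_mult)
  then show ?thesis by (simp add: field_simps)
qed

section \<open>Invariant assortments as ballot lists\<close>

text \<open>With no block occupied, the invariant of \<open>all_park_blocks\<close> says that at
  most \<open>n - d\<close> entries are \<open>d\<close> or more. This does not depend on the order,
  so it can be checked on \<open>as\<close>, whose first \<open>d\<close> entries are below
  \<open>d\<close>.\<close>

lemma ballot_list_in_PA:
  assumes c: "c \<ge> 1" and "as": "as \<in> ballot_lists n k" and mset: "mset bs = mset as"
  shows "map (\<lambda>a. c * a + 1) bs \<in> PA (replicate n c)"
proof -
  have len: "length as = n" and le: "\<And>i. i < n \<Longrightarrow> as ! i \<le> i"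
    using "as" by (auto simp: ballot_lists_def)
  have lt: "a < n" if "a \<in> set bs" for a
  proof -
    have "a \<in> set as" using that mset mset_eq_setD by blast
    then show ?thesis using le len by (fastforce simp: in_set_conv_nth)
  qed
  have lenb: "length bs = n" using mset len mset_eq_length by blast
  have "c * a + 1 \<le> n * c" if "a \<in> set bs" for a
    using mult_le_mono2[of "Suc a" n c] lt[OF that] c by (simp add: mult.commute)
  moreover have "all_park (n * c) (\<Union>(block c ` {})) (map (\<lambda>a. c * a + 1) bs)
      (replicate (length bs) c)"
  proof (rule all_park_blocks[OF c])
    fix d assume "d \<le> n"
    have "length (filter (\<lambda>a. d \<le> a) bs) = size (filter_mset (\<lambda>a. d \<le> a) (mset as))"
      by (simp flip: mset mset_filter)
    also have "\<dots> = length (filter (\<lambda>a. d \<le> a) (take d as @ drop d as))"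
      by (simp flip: mset_filter)
    also have "\<dots> = length (filter (\<lambda>a. d \<le> a) (drop d as))"
    proof -
      have "a < d" if "a \<in> set (take d as)" for a
        using that le len by (fastforce simp: in_set_conv_nth)
      then have "filter (\<lambda>a. d \<le> a) (take d as) = []" by (force simp: filter_empty_conv)
      then show ?thesis unfolding filter_append by simp
    qed
    also have "\<dots> \<le> n - d" using length_filter_le[of _ "drop d as"] len by simp
    finally show "card ({} \<inter> {d..}) + length (filter (\<lambda>a. d \<le> a) bs) \<le> n - d" by simp
  qed (use lt in auto)
  ultimately show ?thesis
    using lenb by (auto simp: PA_def sum_list_replicate)
qed

lemma PA_inv_incr_replicate:
  assumes c: "c \<ge> 1"
  shows "PA_inv_incr (replicate n c) = map (\<lambda>a. c * a + 1) ` ballot_lists n n"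
proof -
  \<comment> \<open>\<open>?g\<close> is a left inverse of \<open>?f\<close>; for
    \<open>?f (?g p) = p\<close> one needs \<open>p \<ge> 1\<close> and \<open>c dvd p - 1\<close>,
    the latter supplied by \<open>PA_inv_dvd\<close>.\<close>
  let ?f = "\<lambda>a. c * a + 1" and ?g = "\<lambda>p. (p - 1) div c"
  show ?thesis
  proof (intro Set.equalityI subsetI)
    fix x assume x: "x \<in> PA_inv_incr (replicate n c)"
    then have inv: "x \<in> PA_inv (replicate n c)" and PA: "x \<in> PA (replicate n c)" and "sorted x"
      by (auto simp: PA_inv_incr_def PA_inv_def)
    have len: "length x = n" and pos: "\<And>p. p \<in> set x \<Longrightarrow> p \<ge> 1"
      using PA by (auto simp: PA_def)
    have nth: "map ?g x ! i \<le> i" if "i < n" for i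
    proof -
      have "x ! i - 1 \<le> c * i" using sorted_PA_nth_le[OF PA c \<open>sorted x\<close> that] by simp
      then have "?g (x ! i) \<le> c * i div c" by (rule div_le_mono)
      then show ?thesis using that len c by simp
    qed
    have "sorted (map ?g x)"
      unfolding sorted_map using \<open>sorted x\<close>
      by (rule sorted_wrt_mono_rel[rotated]) (simp add: div_le_mono diff_le_mono)
    moreover have "a \<le> n" if a: "a \<in> set (map ?g x)" for a
    proof -
      obtain i where "i < n" "a = map ?g x ! i"
        using a unfolding in_set_conv_nth length_map len by blast
      then show ?thesis using nth[of i] by simp
    qed
    ultimately have "map ?g x \<in> ballot_lists n n"
      using nth len by (auto simp: ballot_lists_def)
    moreover have "map ?f (map ?g x) = x"
      unfolding map_map
    proof (rule map_idI)
      fix p assume "p \<in> set x"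
      then show "(?f \<circ> ?g) p = p" using PA_inv_dvd[OF inv c] pos[of p] by simp
    qed
    ultimately show "x \<in> map ?f ` ballot_lists n n" by (metis image_eqI)
  next
    fix x assume "x \<in> map ?f ` ballot_lists n n"
    then obtain "as" where "as": "as \<in> ballot_lists n n" and x: "x = map ?f as" by blast
    have gf: "?g (?f a) = a" for a using c by simp
    have "x' \<in> PA (replicate n c)" if "mset x' = mset x" for x'
    proof -
      have "set x' = set x" using that by (rule mset_eq_setD)
      \<comment> \<open>A rearrangement of \<open>x\<close> still has all its entries in the range
        of \<open>?f\<close>, so it pulls back along \<open>?g\<close> to a rearrangement of
        \<open>as\<close>.\<close>
      then have "map ?f (map ?g x') = x'"
        using gf unfolding map_map by (intro map_idI) (auto simp: x)
      moreover have "mset (map ?g x') = mset as"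
        using c by (simp add: that x image_mset.compositionality comp_def)
      ultimately show ?thesis using ballot_list_in_PA[OF c "as"] by metis
    qed
    moreover have "sorted x"
      using "as" by (auto simp: x ballot_lists_def sorted_iff_nth_mono)
    ultimately show "x \<in> PA_inv_incr (replicate n c)"
      by (simp add: PA_inv_incr_def PA_inv_def)
  qed
qed

theorem corollary3p3:
  fixes n c :: nat
  assumes "n \<ge> 1" and "c \<ge> 1"
  shows "real (card (PA_inv_incr (replicate n c))) = 1 / real (n + 1) * real ((2 * n) choose n)"
proof -
  have "inj (\<lambda>a. c * a + 1)" using assms(2) by (auto simp: inj_def)
  then have "inj_on (map (\<lambda>a. c * a + 1)) (ballot_lists n n)"
    by (metis inj_mapI inj_on_subset subset_UNIV)
  then show ?thesis
    using card_ballot_lists_diag by (simp add: PA_inv_incr_replicate[OF assms(2)] card_image)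
qed

end
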